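(* Let $w=x_1\cdots x_n$ be a Gog word of size $n$, let $a=(a_{i,j})$ be the corresponding monotone triangle, and let $1\le i\le n-1$. Assume that $w$ does not contain the 312-subpattern at any position less than $i$. Then $w$ contains the 312-subpattern at position $i$ if and only if there exists a gap in $a$ at row $i$.
   Context: The Gog alphabet $\mathcal A$ is the set of tuples $(p_1,q_1,\dots,p_{k-1},q_{k-1},p_k)$ of integers, $k\ge 1$, with $1\le p_1<q_1<\cdots<p_{k-1}<q_{k-1}<p_k$. Positions inside a tuple are numbered from 1, so the $p$'s are in odd positions and the $q$'s in even positions. A Gog word of size $n$ is a word $w=x_1\cdots x_n$ of length $n$ with letters in $\mathcal A$ such that: each letter has maximum entry at most $n$; every integer in an even position of a tuple also appears in an odd position in some tuple to its left and in an odd position in some tuple to its right; and every repeated integer alternates between odd and even positions in the successive tuples in which it appears. The monotone triangle $a=(a_{i,j})_{n\ge i\ge j\ge 1}$ corresponding to $w$ is defined as follows: its first row is the single entry of $x_1$; its $i$-th row is obtained from its $(i-1)$-th row by removing the elements in even positions of $x_i$, adding the elements in odd positions of $x_i$, and sorting in increasing order. It has a gap at row $i$ (where $1\le i<n$) if $a_{i,j}-a_{i+1,j}>1$ for some $1\le j\le i$. An integer $m$ is active with respect to a tuple $x=(p_1,q_1,\dots,p_{k-1},q_{k-1},p_k)$ if $m>p_k$ or if $p_j<m<q_j$ for some $j\in\{1,\dots,k-1\}$. Integers $c,a,b$ form a 312-subpattern of $w$, located at $x_i,x_j,x_k$ with $i<j<k$, if: (1) $c,a,b$ appear in odd positions in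 $x_i,x_j,x_k$ respectively; (2) $b$ is not in an even position in any of $x_{i+1},\dots,x_{k-1}$; (3) $b$ is active with respect to $x_j$; (4) $a<b<c$. The word $w$ contains the 312-subpattern at position $i$ if there are $k>i+1$ and integers $c,a,b$ forming a 312-subpattern of $w$ located at $x_i,x_{i+1},x_k$. *)

theory Defs
  imports Main
begin

text \<open>Positions in tuples, rows and words are numbered from 1.\<close>

definition entry :: "'a list \<Rightarrow> nat \<Rightarrow> 'a" where
  "entry xs l = xs ! (l - 1)"

text \<open>
  A tuple \<open>(p\<^sub>1, q\<^sub>1, \<dots>, p\<^sub>k)\<close> is a list of length \<open>2k - 1\<close> with
  \<open>p\<^sub>j\<close> in position \<open>2j - 1\<close> and \<open>q\<^sub>j\<close> in position \<open>2j\<close>.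
\<close>

definition gog_alphabet :: "int list set" where
  "gog_alphabet = {x. odd (length x) \<and> sorted_wrt (<) x \<and> (\<forall>m\<in>set x. 1 \<le> m)}"

definition in_odd :: "int \<Rightarrow> int list \<Rightarrow> bool" where
  "in_odd m x \<longleftrightarrow> (\<exists>l. 1 \<le> l \<and> l \<le> length x \<and> odd l \<and> entry x l = m)"

definition in_even :: "int \<Rightarrow> int list \<Rightarrow> bool" where
  "in_even m x \<longleftrightarrow> (\<exists>l. 1 \<le> l \<and> l \<le> length x \<and> even l \<and> entry x l = m)"

text \<open>
  In the last clause, \<open>i\<close> and \<open>k\<close> are successive occurrences of \<open>m\<close>; the entries of
  a tuple are distinct, so \<open>m\<close> occurs in a given tuple at most once.
\<close>

definition gog_word :: "nat \<Rightarrow> int list list \<Rightarrow> bool" where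
  "gog_word n w \<longleftrightarrow>
     length w = n \<and>
     (\<forall>x\<in>set w. x \<in> gog_alphabet) \<and>
     (\<forall>x\<in>set w. \<forall>m\<in>set x. m \<le> int n) \<and>
     (\<forall>m j. 1 \<le> j \<and> j \<le> n \<and> in_even m (entry w j) \<longrightarrow>
        (\<exists>i. 1 \<le> i \<and> i < j \<and> in_odd m (entry w i)) \<and>
        (\<exists>k. j < k \<and> k \<le> n \<and> in_odd m (entry w k))) \<and>
     (\<forall>m i k. 1 \<le> i \<and> i < k \<and> k \<le> n \<and>
        m \<in> set (entry w i) \<and> m \<in> set (entry w k) \<and>
        (\<forall>j. i < j \<and> j < k \<longrightarrow> m \<notin> set (entry w j)) \<longrightarrow>
        (in_odd m (entry w i) \<and> in_even m (entry w k)) \<or>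
        (in_even m (entry w i) \<and> in_odd m (entry w k)))"

text \<open>Row 0 is a dummy value.\<close>

fun triangle_row :: "int list list \<Rightarrow> nat \<Rightarrow> int list" where
  "triangle_row w 0 = []"
| "triangle_row w (Suc 0) = [entry (entry w 1) 1]"
| "triangle_row w (Suc (Suc i)) =
     sorted_list_of_set
       ((set (triangle_row w (Suc i)) - {m. in_even m (entry w (Suc (Suc i)))})
        \<union> {m. in_odd m (entry w (Suc (Suc i)))})"

definition monotone_triangle :: "int list list \<Rightarrow> nat \<Rightarrow> nat \<Rightarrow> int" where
  "monotone_triangle w i j = entry (triangle_row w i) j"

definition has_gap_at_row :: "(nat \<Rightarrow> nat \<Rightarrow> int) \<Rightarrow> nat \<Rightarrow> bool" where
  "has_gap_at_row a i \<longleftrightarrow> (\<exists>j. 1 \<le> j \<and> j \<le> i \<and> a i j - a (i + 1) j > 1)"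

definition active :: "int \<Rightarrow> int list \<Rightarrow> bool" where
  "active m x \<longleftrightarrow>
     m > last x \<or>
     (\<exists>j. 1 \<le> j \<and> 2 * j < length x \<and> entry x (2 * j - 1) < m \<and> m < entry x (2 * j))"

definition subpattern_312 ::
  "int list list \<Rightarrow> int \<Rightarrow> int \<Rightarrow> int \<Rightarrow> nat \<Rightarrow> nat \<Rightarrow> nat \<Rightarrow> bool" where
  "subpattern_312 w c a b i j k \<longleftrightarrow>
     1 \<le> i \<and> i < j \<and> j < k \<and> k \<le> length w \<and>
     in_odd c (entry w i) \<and> in_odd a (entry w j) \<and> in_odd b (entry w k) \<and>
     (\<forall>l. i + 1 \<le> l \<and> l \<le> k - 1 \<longrightarrow> \<not> in_even b (entry w l)) \<and>
     active b (entry w j) \<and>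
     a < b \<and> b < c"

definition contains_312_at :: "int list list \<Rightarrow> nat \<Rightarrow> bool" where
  "contains_312_at w i \<longleftrightarrow> (\<exists>k c a b. k > i + 1 \<and> subpattern_312 w c a b i (i + 1) k)"

end

theory Submission
  imports Defs
begin

text \<open>
  Let \<open>S\<^sub>j\<close> be the set of entries of row \<open>j\<close> of the triangle. Since repeated integers
  alternate, letter \<open>x\<^sub>j\<close> removes from \<open>S\<^sub>j\<^sub>-\<^sub>1\<close> only integers that are there and adds only
  integers that are not (\<open>evens_subset_row\<close>, \<open>odds_Int_row\<close>). The alternating shape
  \<open>p\<^sub>1 < q\<^sub>1 < \<dots> < p\<^sub>k\<close> of a letter then says how counting functions change: the number
  of entries at most \<open>t\<close> goes up by one if \<open>t\<close> is active or is some \<open>p\<^sub>j\<close>, and stays the same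
  otherwise (\<open>count_row_Suc\<close>). In particular \<open>S\<^sub>j\<close> has \<open>j\<close> elements and \<open>S\<^sub>n\<close> is
  \<open>{1..n}\<close>.

  Reading the entries of a sorted row off its counting function, a gap at row \<open>i\<close> means
  exactly that some integer \<open>b\<close> is missing from both \<open>S\<^sub>i\<close> and \<open>S\<^sub>i\<^sub>+\<^sub>1\<close>, is active with respect to
  \<open>x\<^sub>i\<^sub>+\<^sub>1\<close>, and lies below some \<open>c \<in> S\<^sub>i\<close> (\<open>gap_iff_open\<close>). A 312-subpattern at
  position \<open>i\<close> gives such a \<open>b\<close>: its \<open>b\<close> is added at a later step without being removed in
  between, so it was absent all along (\<open>open_if_contains_312\<close>).

  Conversely, suppose such a \<open>b\<close> is given. It belongs to \<open>S\<^sub>n\<close>, so some later letter adds it, and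
  activity provides an \<open>a = p\<^sub>1 < b\<close> in \<open>x\<^sub>i\<^sub>+\<^sub>1\<close>. Only the \<open>c\<close> may be
  missing: it lies in \<open>S\<^sub>i\<close>, but perhaps was added before \<open>x\<^sub>i\<close>. If all of \<open>x\<^sub>i\<close> is
  below \<open>b\<close>, then \<open>b\<close> is active with respect to \<open>x\<^sub>i\<close> as well, \<open>c\<close> is already in
  \<open>S\<^sub>i\<^sub>-\<^sub>1\<close>, and the same \<open>b\<close> serves one row earlier. Descending in this way ends in a
  312-subpattern at some position at most \<open>i\<close> (\<open>contains_312_if_open\<close>); if there is none before
  \<open>i\<close>, it is at \<open>i\<close>.
\<close>

section \<open>Odd and even positions of a tuple\<close>

definition odds :: "int list \<Rightarrow> int set" where
  "odds x = {m. in_odd m x}"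

definition evens :: "int list \<Rightarrow> int set" where
  "evens x = {m. in_even m x}"

text \<open>
  The number of elements of \<open>A\<close> that are at most \<open>t\<close>. Rows are compared through this function
  because it changes additively from one row to the next, whereas the sorted entries do not.
\<close>

definition count_le :: "int set \<Rightarrow> int \<Rightarrow> nat" where
  "count_le A t = card {s \<in> A. s \<le> t}"

lemma odds_Nil [simp]: "odds [] = {}" and evens_Nil [simp]: "evens [] = {}"
  by (auto simp: odds_def evens_def in_odd_def in_even_def)

text \<open>Prepending an entry swaps the two parities, so both sets satisfy a mutual recursion.\<close>

lemma odds_Cons [simp]: "odds (p # x) = insert p (evens x)"
proof (intro set_eqI iffI)
  fix m assume "m \<in> odds (p # x)"
  then obtain l where l: "1 \<le> l" "l \<le> Suc (length x)" "odd l" "entry (p # x) l = m"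
    by (auto simp: odds_def in_odd_def)
  show "m \<in> insert p (evens x)"
  proof (cases "l = 1")
    case True then show ?thesis using l by (simp add: entry_def)
  next
    case False
    then obtain l' where "l = Suc (Suc l')" using l by (metis One_nat_def not0_implies_Suc not_one_le_zero)
    then have "1 \<le> l - 1 \<and> l - 1 \<le> length x \<and> even (l - 1) \<and> entry x (l - 1) = m"
      using l by (auto simp: entry_def)
    then show ?thesis unfolding evens_def in_even_def by blast
  qed
next
  fix m assume "m \<in> insert p (evens x)"
  then consider "m = p" | l where "1 \<le> l" "l \<le> length x" "even l" "entry x l = m"
    by (auto simp: evens_def in_even_def)
  then show "m \<in> odds (p # x)"
  proof cases
    case 1 then show ?thesis
      by (auto simp: odds_def in_odd_def entry_def intro!: exI[of _ 1])
  next
    case 2 then show ?thesis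
      by (auto simp: odds_def in_odd_def entry_def nth_Cons' intro!: exI[of _ "Suc l"])
  qed
qed

lemma evens_Cons [simp]: "evens (p # x) = odds x"
proof (intro set_eqI iffI)
  fix m assume "m \<in> evens (p # x)"
  then obtain l where l: "1 \<le> l" "l \<le> Suc (length x)" "even l" "entry (p # x) l = m"
    by (auto simp: evens_def in_even_def)
  then obtain l' where "l = Suc (Suc l')"
    by (metis One_nat_def not0_implies_Suc not_one_le_zero odd_one)
  then have "1 \<le> l - 1 \<and> l - 1 \<le> length x \<and> odd (l - 1) \<and> entry x (l - 1) = m"
    using l by (auto simp: entry_def)
  then show "m \<in> odds x" unfolding odds_def in_odd_def by blast
next
  fix m assume "m \<in> odds x"
  then obtain l where "1 \<le> l" "l \<le> length x" "odd l" "entry x l = m"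
    by (auto simp: odds_def in_odd_def)
  then show "m \<in> evens (p # x)"
    by (auto simp: evens_def in_even_def entry_def nth_Cons' intro!: exI[of _ "Suc l"])
qed

lemma odds_Un_evens: "odds x \<union> evens x = set x"
  by (induction x) auto

lemma finite_odds [simp]: "finite (odds x)" and finite_evens [simp]: "finite (evens x)"
  using odds_Un_evens[of x] by (metis List.finite_set finite_Un)+

lemma odds_Int_evens: "distinct x \<Longrightarrow> odds x \<inter> evens x = {}"
proof (induction x)
  case (Cons p x)
  then show ?case using odds_Un_evens[of x] by auto
qed simp

lemma last_in_odds: "odd (length x) \<Longrightarrow> last x \<in> odds x"
  by (induction x rule: induct_list012) auto

section \<open>Active integers and counting in a letter\<close>

lemma active_singleton: "active m [p] \<longleftrightarrow> p < m"
  by (auto simp: active_def)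

lemma active_Cons_Cons:
  assumes "x \<noteq> []"
  shows "active m (p # q # x) \<longleftrightarrow> p < m \<and> m < q \<or> active m x"
proof -
  let ?P = "\<lambda>x j. 2 * j < length x \<and> entry x (2 * j - 1) < m \<and> m < entry x (2 * j)"
  have shift: "?P (p # q # x) (Suc j) \<longleftrightarrow> ?P x j" if "1 \<le> j" for j
    using that by (auto simp: entry_def nth_Cons')
  have first: "?P (p # q # x) 1 \<longleftrightarrow> p < m \<and> m < q"
    using assms by (auto simp: entry_def)
  have split: "(\<exists>j\<ge>1. Q j) \<longleftrightarrow> Q 1 \<or> (\<exists>j\<ge>1. Q (Suc j))" for Q :: "nat \<Rightarrow> bool"
  proof
    assume "\<exists>j\<ge>1. Q j"
    then obtain j where "1 \<le> j" "Q j" by blast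
    then show "Q 1 \<or> (\<exists>j\<ge>1. Q (Suc j))" by (cases "j = 1"; cases j) auto
  qed auto
  have "(\<exists>j\<ge>1. ?P (p # q # x) j) \<longleftrightarrow> ?P (p # q # x) 1 \<or> (\<exists>j\<ge>1. ?P (p # q # x) (Suc j))"
    by (rule split)
  also have "\<dots> \<longleftrightarrow> p < m \<and> m < q \<or> (\<exists>j\<ge>1. ?P x j)"
    using first shift by blast
  finally show ?thesis using assms unfolding active_def by auto
qed

lemma count_le_empty [simp]: "count_le {} t = 0"
  by (simp add: count_le_def)

lemma count_le_insert:
  "finite A \<Longrightarrow> p \<notin> A \<Longrightarrow> count_le (insert p A) t = count_le A t + of_bool (p \<le> t)"
proof -
  assume *: "finite A" "p \<notin> A"
  have "{s \<in> insert p A. s \<le> t} = (if p \<le> t then insert p {s \<in> A. s \<le> t} else {s \<in> A. s \<le> t})"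
    by auto
  then show ?thesis using * by (simp add: count_le_def)
qed

lemma count_le_pred:
  assumes "finite A"
  shows "count_le A t = count_le A (t - 1) + of_bool (t \<in> A)"
proof -
  have "{s \<in> A. s \<le> t} = (if t \<in> A then insert t {s \<in> A. s \<le> t - 1} else {s \<in> A. s \<le> t - 1})"
    by (auto simp: le_less)
  then show ?thesis using assms by (simp add: count_le_def)
qed

text \<open>
  The \<open>p\<close>'s and \<open>q\<close>'s interlace, starting with a \<open>p\<close>. Hence at each \<open>t\<close> the \<open>p\<close>'s are
  ahead by one or level, and they are ahead exactly when \<open>t\<close> lies in some \<open>{p\<^sub>j..<q\<^sub>j}\<close>
  or is at least \<open>p\<^sub>k\<close>.
\<close>

lemma letter_count:
  assumes "odd (length x)" and "sorted_wrt (<) x"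
  shows "count_le (odds x) t = count_le (evens x) t + of_bool (active t x \<or> t \<in> odds x)"
  using assms
proof (induction x rule: induct_list012)
  case 1 then show ?case by simp
next
  case (2 p)
  then show ?case by (auto simp: active_singleton count_le_insert)
next
  case (3 p q x)
  then have x: "x \<noteq> []" "odd (length x)" and pq: "p < q" and q: "\<forall>m\<in>set x. q < m"
    by auto
  have out: "m \<in> odds x \<or> m \<in> evens x \<Longrightarrow> q < m" for m
    using q odds_Un_evens[of x] by blast
  have "\<not> active t x" if "t \<le> q"
  proof -
    have *: "q < entry x l" if "1 \<le> l" "l \<le> length x" for l
      using that q by (simp add: entry_def)
    have "q < last x" using q x by simp
    moreover have "\<not> (entry x (2 * j - 1) < t)" if "1 \<le> j" "2 * j < length x" for j
    proof -
      have "q < entry x (2 * j - 1)" by (rule *) (use that in linarith)+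
      then show ?thesis using \<open>t \<le> q\<close> by simp
    qed
    ultimately show ?thesis using \<open>t \<le> q\<close> unfolding active_def by auto
  qed
  moreover have "count_le (odds x) t = count_le (evens x) t + of_bool (active t x \<or> t \<in> odds x)"
    using 3 by auto
  \<comment> \<open>Below \<open>q\<close> only \<open>p\<close> can matter; from \<open>q\<close> on, \<open>p\<close> and \<open>q\<close> add one to each count.\<close>
  moreover have "p \<notin> odds x" "q \<notin> evens x" using out pq by force+
  ultimately show ?case using x pq out[of t]
    by (cases "t < p"; cases "t = p"; cases "t < q"; cases "t = q")
       (auto simp: active_Cons_Cons count_le_insert)
qed

lemma odd_below_if_active:
  assumes "odd (length x)" "sorted_wrt (<) x" "active b x"
  shows "\<exists>a\<in>odds x. a \<le> b"
proof -
  have "count_le (odds x) b > 0" using letter_count[of x b] assms by simp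
  then show ?thesis unfolding count_le_def by (auto simp: card_gt_0_iff)
qed

lemma strict_sorted_le_last:
  fixes x :: "int list"
  shows "sorted_wrt (<) x \<Longrightarrow> m \<in> set x \<Longrightarrow> m \<le> last x"
  by (induction x) (auto simp: le_less)

text \<open>
  This turns inequalities between entries of a sorted list into inequalities between counts.
\<close>

lemma sorted_nth_le_iff:
  fixes xs :: "int list"
  assumes "sorted_wrt (<) xs" and "k < length xs"
  shows "xs ! k \<le> t \<longleftrightarrow> k < count_le (set xs) t"
  using assms
proof (induction xs arbitrary: k)
  case (Cons p xs)
  have p: "p \<notin> set xs" using Cons.prems by auto
  have low: "count_le (set xs) t = 0" if "t < p"
    using Cons.prems that by (force simp: count_le_def)
  show ?case
  proof (cases k)
    case 0
    then show ?thesis using p low by (cases "t < p") (auto simp: count_le_insert)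
  next
    case (Suc k')
    then have "xs ! k' \<le> t \<longleftrightarrow> k' < count_le (set xs) t" using Cons by auto
    moreover have "p < xs ! k'" using Cons.prems Suc by auto
    ultimately show ?thesis using p low Suc by (auto simp: count_le_insert)
  qed
qed simp

section \<open>Rows of the triangle of a Gog word\<close>

locale gog =
  fixes n :: nat and w :: "int list list"
  assumes gog: "gog_word n w"
begin

abbreviation row :: "nat \<Rightarrow> int set" where
  "row j \<equiv> set (triangle_row w j)"

lemma letter_wellformed:
  assumes "1 \<le> j" "j \<le> n"
  shows "odd (length (entry w j))" "sorted_wrt (<) (entry w j)" "distinct (entry w j)"
    "set (entry w j) \<subseteq> {1..int n}"
proof -
  have mem: "entry w j \<in> set w" using assms gog by (auto simp: gog_word_def entry_def)
  then have "entry w j \<in> gog_alphabet" using gog by (auto simp: gog_word_def)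
  then show "odd (length (entry w j))" "sorted_wrt (<) (entry w j)" "distinct (entry w j)"
    "set (entry w j) \<subseteq> {1..int n}"
    using mem gog by (auto simp: gog_alphabet_def gog_word_def strict_sorted_iff)
qed

lemma odd_before_even:
  assumes "1 \<le> j" "j \<le> n" "in_even m (entry w j)"
  shows "\<exists>i. 1 \<le> i \<and> i < j \<and> in_odd m (entry w i)"
  using gog assms unfolding gog_word_def by blast

text \<open>
  This includes the step to the first row, which is not defined as an update: the first letter has
  no even positions because nothing to its left could account for them, so it is a single entry.
\<close>

lemma row_Suc:
  assumes "j < n"
  shows "row (Suc j) = row j - evens (entry w (Suc j)) \<union> odds (entry w (Suc j))"
proof (cases j)
  case 0
  have "odd (length (entry w 1))" using letter_wellformed(1)[of 1] assms by simp
  then obtain p x where px: "entry w 1 = p # x" by (cases "entry w 1") auto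
  have "evens (entry w 1) = {}"
    using odd_before_even[of 1] assms by (auto simp: evens_def)
  then have "x = []" using px by (cases x) auto
  with px show ?thesis using 0 by (simp add: entry_def)
next
  case (Suc k)
  then show ?thesis
    using finite_odds[of "entry w (Suc j)"] by (simp add: odds_def evens_def)
qed

lemma sorted_row: "sorted_wrt (<) (triangle_row w j)"
  by (induction w j rule: triangle_row.induct) auto

text \<open>
  Membership in a row is decided by the parity of the last occurrence so far. The alternation
  condition speaks of consecutive occurrences, and this is how it bears on rows.
\<close>

lemma mem_row_iff:
  assumes "j \<le> n"
  shows "m \<in> row j \<longleftrightarrow>
    (\<exists>t. 1 \<le> t \<and> t \<le> j \<and> in_odd m (entry w t) \<and> (\<forall>s. t < s \<and> s \<le> j \<longrightarrow> m \<notin> set (entry w s)))"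
    (is "_ \<longleftrightarrow> (\<exists>t. ?P j t)")
  using assms
proof (induction j)
  case 0
  then show ?case by auto
next
  case (Suc j)
  let ?x = "entry w (Suc j)"
  have x: "odds ?x \<inter> evens ?x = {}" "odds ?x \<union> evens ?x = set ?x"
    using odds_Int_evens letter_wellformed(3)[of "Suc j"] odds_Un_evens Suc.prems by auto
  consider "m \<in> odds ?x" | "m \<in> evens ?x" "m \<notin> odds ?x" | "m \<notin> set ?x"
    using x by blast
  then show ?case
  proof cases
    case 1
    then have "?P (Suc j) (Suc j)" by (auto simp: odds_def)
    then have "\<exists>t. ?P (Suc j) t" by blast
    moreover have "m \<in> row (Suc j)" using 1 row_Suc[of j] Suc.prems by auto
    ultimately show ?thesis by simp
  next
    case 2
    then have "\<not> ?P (Suc j) t" for t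
      using x by (cases "t = Suc j") (auto simp: odds_def intro!: exI[of _ "Suc j"])
    then show ?thesis using 2 row_Suc[of j] Suc.prems by auto
  next
    case 3
    then have "?P (Suc j) t \<longleftrightarrow> ?P j t" for t
      using x by (auto simp: odds_def le_Suc_eq)
    then show ?thesis using 3 x row_Suc[of j] Suc.prems Suc.IH by auto
  qed
qed

lemma alternation:
  assumes "1 \<le> i" "i < k" "k \<le> n" "m \<in> set (entry w i)" "m \<in> set (entry w k)"
    and "\<And>j. i < j \<Longrightarrow> j < k \<Longrightarrow> m \<notin> set (entry w j)"
  shows "in_odd m (entry w i) \<and> in_even m (entry w k) \<or>
    in_even m (entry w i) \<and> in_odd m (entry w k)"
  using gog assms unfolding gog_word_def by blast

text \<open>
  By alternation, the last occurrence before an even one is odd; there is a previous occurrence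
  because an even occurrence has an odd one to its left.
\<close>

lemma evens_subset_row:
  assumes "j < n"
  shows "evens (entry w (Suc j)) \<subseteq> row j"
proof
  fix m assume m: "m \<in> evens (entry w (Suc j))"
  let ?P = "\<lambda>t. 1 \<le> t \<and> t \<le> j \<and> m \<in> set (entry w t)"
  have later: "m \<in> set (entry w (Suc j))" using m odds_Un_evens by blast
  obtain t0 where "1 \<le> t0" "t0 < Suc j" "in_odd m (entry w t0)"
    using odd_before_even[of "Suc j" m] m assms by (auto simp: evens_def)
  then have t0: "?P t0" using odds_Un_evens[of "entry w t0"] by (auto simp: odds_def)
  \<comment> \<open>The last occurrence of \<open>m\<close> among the first \<open>j\<close> letters.\<close>
  define t where "t = Greatest ?P"
  have t: "?P t" unfolding t_def by (rule GreatestI_nat[of ?P t0 j]) (use t0 in auto)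
  have gone: "m \<notin> set (entry w s)" if "t < s" "s \<le> j" for s
  proof
    assume "m \<in> set (entry w s)"
    then have "?P s" using that t by auto
    then have "s \<le> t" unfolding t_def by (rule Greatest_le_nat[of ?P s j]) auto
    then show False using that by simp
  qed
  have "m \<notin> odds (entry w (Suc j))"
    using m odds_Int_evens letter_wellformed(3)[of "Suc j"] assms by auto
  moreover have "in_odd m (entry w t) \<and> in_even m (entry w (Suc j)) \<or>
      in_even m (entry w t) \<and> in_odd m (entry w (Suc j))"
    using t gone later assms by (intro alternation) auto
  ultimately have "in_odd m (entry w t)" by (auto simp: odds_def)
  then show "m \<in> row j" using t gone assms mem_row_iff[of j] by auto
qed

text \<open>An integer still present had an odd last occurrence, so its next one is even.\<close>

lemma odds_Int_row:
  assumes "j < n"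
  shows "odds (entry w (Suc j)) \<inter> row j = {}"
proof -
  have False if m: "m \<in> odds (entry w (Suc j))" "m \<in> row j" for m
  proof -
    obtain t where t: "1 \<le> t" "t \<le> j" "in_odd m (entry w t)"
      and gone: "\<forall>s. t < s \<and> s \<le> j \<longrightarrow> m \<notin> set (entry w s)"
      using m mem_row_iff[of j] assms by auto
    have "m \<in> set (entry w t)" "m \<in> set (entry w (Suc j))"
      using t m odds_Un_evens by (auto simp: odds_def)
    then have "in_odd m (entry w t) \<and> in_even m (entry w (Suc j)) \<or>
        in_even m (entry w t) \<and> in_odd m (entry w (Suc j))"
      using t gone assms by (intro alternation) auto
    moreover have "m \<notin> evens (entry w (Suc j))" "m \<notin> evens (entry w t)"
      using m t odds_Int_evens letter_wellformed(3)[of "Suc j"] letter_wellformed(3)[of t] assms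
      by (auto simp: odds_def)
    ultimately show False by (auto simp: evens_def)
  qed
  then show ?thesis by blast
qed

text \<open>
  As removals and additions take effect in full, the count changes by the excess of \<open>p\<close>'s over
  \<open>q\<close>'s up to \<open>t\<close>. In particular it changes by at most one, which is the interlacing of
  consecutive rows.
\<close>

lemma count_row_Suc:
  assumes "j < n"
  shows "count_le (row (Suc j)) t =
    count_le (row j) t + of_bool (active t (entry w (Suc j)) \<or> t \<in> odds (entry w (Suc j)))"
proof -
  let ?O = "odds (entry w (Suc j))" and ?E = "evens (entry w (Suc j))"
  have "count_le (row (Suc j)) t = count_le (row j - ?E) t + count_le ?O t"
    unfolding count_le_def using row_Suc[OF assms] odds_Int_row[OF assms]
    by (subst card_Un_disjoint[symmetric]) (auto intro: arg_cong[where f = card])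
  moreover have "count_le (row j) t = count_le (row j - ?E) t + count_le ?E t"
    unfolding count_le_def using evens_subset_row[OF assms]
    by (subst card_Un_disjoint[symmetric]) (auto intro: arg_cong[where f = card])
  ultimately show ?thesis
    using letter_count[of "entry w (Suc j)" t] letter_wellformed[of "Suc j"] assms by simp
qed

lemma row_subset: "j \<le> n \<Longrightarrow> row j \<subseteq> {1..int n}"
proof (induction j)
  case (Suc j)
  then show ?case
    using row_Suc[of j] letter_wellformed(4)[of "Suc j"] odds_Un_evens[of "entry w (Suc j)"] by auto
qed simp

text \<open>
  Evaluate the counting function at \<open>n\<close>, which is an upper bound of all entries: there each letter
  adds one, since \<open>n\<close> is either its last entry or above it.
\<close>

lemma card_row: "j \<le> n \<Longrightarrow> card (row j) = j"
proof (induction j)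
  case (Suc j)
  let ?x = "entry w (Suc j)"
  have whole: "count_le (row k) (int n) = card (row k)" if "k \<le> n" for k
  proof -
    have "{s \<in> row k. s \<le> int n} = row k" using row_subset[OF that] by auto
    then show ?thesis by (simp add: count_le_def)
  qed
  have "last ?x \<in> odds ?x" using last_in_odds letter_wellformed(1)[of "Suc j"] Suc.prems by simp
  then have "active (int n) ?x \<or> int n \<in> odds ?x"
    using letter_wellformed(4)[of "Suc j"] Suc.prems odds_Un_evens[of ?x]
    by (cases "last ?x = int n") (force simp: active_def)+
  then show ?case using count_row_Suc[of j "int n"] whole[of j] whole[of "Suc j"] Suc by simp
qed simp

lemma length_row: "j \<le> n \<Longrightarrow> length (triangle_row w j) = j"
  using card_row[of j] sorted_row[of j] by (metis distinct_card strict_sorted_iff)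

lemma last_row: "row n = {1..int n}"
  by (rule card_subset_eq) (use row_subset[of n] card_row[of n] in auto)

lemma row_persistent:
  assumes "m \<in> row i" "i \<le> l" "l \<le> n"
    and "\<And>s. i < s \<Longrightarrow> s \<le> l \<Longrightarrow> m \<notin> evens (entry w s)"
  shows "m \<in> row l"
  using assms(2,3,4)
proof (induction l rule: dec_induct)
  case (step l)
  then show ?case using row_Suc[of l] by auto
qed (use assms in simp)

text \<open>
  The last row is all of \<open>{1..n}\<close>, so an absent integer is added at some point; up to the first
  such point there is nothing to remove.
\<close>

lemma row_entered:
  assumes "b \<in> {1..int n}" "b \<notin> row j" "j \<le> n"
  obtains k where "j < k" "k \<le> n" "in_odd b (entry w k)"
    "\<And>l. j < l \<Longrightarrow> l < k \<Longrightarrow> \<not> in_even b (entry w l)"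
proof -
  let ?P = "\<lambda>k. j \<le> k \<and> b \<in> row k"
  have n: "?P n" using assms last_row by simp
  \<comment> \<open>The first row from \<open>j\<close> on that contains \<open>b\<close>.\<close>
  define k where "k = Least ?P"
  have k: "?P k" unfolding k_def by (rule LeastI[of ?P, OF n])
  have "k \<le> n" unfolding k_def by (rule Least_le[of ?P, OF n])
  have before: "b \<notin> row l" if "j \<le> l" "l < k" for l
    using that not_less_Least[of l ?P] unfolding k_def by blast
  have "j < k" using k assms by (cases "j = k") auto
  then obtain k' where k': "k = Suc k'" "j \<le> k'" by (cases k) auto
  have "in_odd b (entry w k)"
    using k before[of k'] k' row_Suc[of k'] \<open>k \<le> n\<close> by (auto simp: odds_def)
  moreover have "\<not> in_even b (entry w l)" if "j < l" "l < k" for l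
  proof -
    obtain l' where "l = Suc l'" using \<open>j < l\<close> by (cases l) auto
    then show ?thesis
      using before[of l'] evens_subset_row[of l'] that \<open>k \<le> n\<close> by (auto simp: evens_def)
  qed
  ultimately show thesis using that \<open>j < k\<close> \<open>k \<le> n\<close> by blast
qed

section \<open>Gaps\<close>

text \<open>
  These are the integers strictly inside the gaps at row \<open>i\<close>, described without naming a column.
  Each of them can play the part of \<open>b\<close> in a 312-subpattern at position \<open>i\<close>, provided that the
  letter \<open>x\<^sub>i\<close> itself supplies a \<open>c\<close>.
\<close>

definition open_at :: "nat \<Rightarrow> int \<Rightarrow> bool" where
  "open_at i b \<longleftrightarrow> b \<notin> row i \<and> b \<notin> row (Suc i) \<and> active b (entry w (Suc i)) \<and> (\<exists>c\<in>row i. b < c)"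

lemma triangle_le_iff:
  assumes "1 \<le> j" "j \<le> i" "i \<le> n"
  shows "monotone_triangle w i j \<le> t \<longleftrightarrow> j \<le> count_le (row i) t"
  using sorted_nth_le_iff[OF sorted_row, of "j - 1" i t] length_row[of i] assms
  by (auto simp: monotone_triangle_def entry_def)

text \<open>
  If \<open>a\<^sub>i\<^sub>+\<^sub>1\<^sub>,\<^sub>j < b < a\<^sub>i\<^sub>,\<^sub>j\<close>, then row \<open>i + 1\<close> is strictly ahead of row \<open>i\<close> in its count at
  \<open>b\<close>, even without \<open>b\<close> itself. A lead of more than one is impossible, so neither row contains
  \<open>b\<close>, and a lead of one makes \<open>b\<close> active. Conversely the count of row \<open>i\<close> at \<open>b\<close> gives the
  column of the gap.
\<close>

lemma gap_iff_open:
  assumes "1 \<le> i" "i < n"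
  shows "has_gap_at_row (monotone_triangle w) i \<longleftrightarrow> (\<exists>b. open_at i b)"
proof
  assume "has_gap_at_row (monotone_triangle w) i"
  then obtain j where j: "1 \<le> j" "j \<le> i"
    and gap: "monotone_triangle w (Suc i) j < monotone_triangle w i j - 1"
    by (auto simp: has_gap_at_row_def)
  \<comment> \<open>Any integer strictly between the two entries would do.\<close>
  define b where "b = monotone_triangle w i j - 1"
  have hi: "count_le (row i) b < j"
    using triangle_le_iff[of j i b] j assms by (simp add: b_def)
  have lo: "j \<le> count_le (row (Suc i)) (b - 1)"
    using triangle_le_iff[of j "Suc i" "b - 1"] j assms gap by (simp add: b_def)
  have step: "count_le (row (Suc i)) t \<le> Suc (count_le (row i) t)" for t
    using count_row_Suc[of i t] assms by (simp only: of_bool_def) simp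
  have notin: "b \<notin> row i" "b \<notin> row (Suc i)"
    using hi lo count_le_pred[of "row i" b] count_le_pred[of "row (Suc i)" b] step[of b] step[of "b - 1"]
    by (simp_all split: if_splits add: of_bool_def)
  have "active b (entry w (Suc i)) \<or> b \<in> odds (entry w (Suc i))"
    using hi lo count_le_pred[of "row (Suc i)" b] count_row_Suc[of i b] assms
    by (intro ccontr[of "_ \<or> _"]) simp
  moreover have "b \<notin> odds (entry w (Suc i))" using notin row_Suc[of i] assms by auto
  moreover have "monotone_triangle w i j \<in> row i"
    using j length_row[of i] assms by (simp add: monotone_triangle_def entry_def)
  moreover have "b < monotone_triangle w i j" by (simp add: b_def)
  ultimately show "\<exists>b. open_at i b"
    using notin unfolding open_at_def by blast
next
  assume "\<exists>b. open_at i b"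
  then obtain b c where b: "b \<notin> row i" "b \<notin> row (Suc i)" "active b (entry w (Suc i))"
    and c: "c \<in> row i" "b < c"
    by (auto simp: open_at_def)
  \<comment> \<open>The column of the least entry of row \<open>i\<close> above \<open>b\<close>, which exists because of \<open>c\<close>.\<close>
  define j where "j = Suc (count_le (row i) b)"
  have "c \<notin> {s \<in> row i. s \<le> b}" using c by simp
  then have "{s \<in> row i. s \<le> b} \<subset> row i" using c by blast
  then have "count_le (row i) b < card (row i)"
    unfolding count_le_def by (intro psubset_card_mono) simp_all
  then have j: "1 \<le> j" "j \<le> i" using card_row[of i] assms by (auto simp: j_def)
  have "\<not> monotone_triangle w i j \<le> b"
    using triangle_le_iff[of j i b] j assms by (simp add: j_def)
  moreover have "monotone_triangle w (Suc i) j \<le> b - 1"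
    using triangle_le_iff[of j "Suc i" "b - 1"] j assms b
      count_le_pred[of "row (Suc i)" b] count_row_Suc[of i b] by (simp add: j_def)
  ultimately show "has_gap_at_row (monotone_triangle w) i"
    using j by (auto simp: has_gap_at_row_def intro!: exI[of _ j])
qed

section \<open>312-subpatterns\<close>

text \<open>
  Had \<open>b\<close> been present in row \<open>i\<close> or \<open>i + 1\<close>, it would still be there when \<open>x\<^sub>k\<close> adds it,
  as no letter in between removes it.
\<close>

lemma open_if_contains_312:
  assumes "1 \<le> i" "i < n" "contains_312_at w i"
  shows "\<exists>b. open_at i b"
proof -
  obtain k c a b where k: "Suc i < k" "k \<le> n"
    and c: "in_odd c (entry w i)" "b < c" and b: "in_odd b (entry w k)" "active b (entry w (Suc i))"
    and none: "\<And>l. i < l \<Longrightarrow> l < k \<Longrightarrow> \<not> in_even b (entry w l)"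
    using assms gog by (auto simp: contains_312_at_def subpattern_312_def gog_word_def)
  obtain k' where k': "k = Suc k'" "Suc i \<le> k'" using k by (cases k) auto
  have "b \<notin> row k'" using b k odds_Int_row[of k'] k' by (auto simp: odds_def)
  then have absent: "b \<notin> row l" if "i \<le> l" "l \<le> k'" for l
    using row_persistent[of b l k'] none that k k' by (auto simp: evens_def)
  have "b \<notin> row i" "b \<notin> row (Suc i)" using absent k' by auto
  moreover have "c \<in> row i"
    using row_Suc[of "i - 1"] c assms by (simp add: odds_def)
  ultimately show ?thesis using b c by (auto simp: open_at_def)
qed

text \<open>
  Descent on \<open>i\<close>: either \<open>x\<^sub>i\<close> itself adds some \<open>c > b\<close>, or \<open>x\<^sub>i\<close> ends below \<open>b\<close> and the
  same \<open>b\<close> and \<open>c\<close> work for \<open>i - 1\<close>. The descent stops because row 0 is empty and so holds no \<open>c\<close>.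
\<close>

lemma contains_312_if_open:
  assumes "1 \<le> i" "i < n" "open_at i b"
  shows "\<exists>l. 1 \<le> l \<and> l \<le> i \<and> contains_312_at w l"
  using assms
proof (induction i)
  case (Suc i)
  let ?x = "entry w (Suc i)"
  let ?y = "entry w (Suc (Suc i))"
  have b: "b \<notin> row (Suc i)" "b \<notin> row (Suc (Suc i))" "active b (entry w (Suc (Suc i)))"
    using Suc.prems by (auto simp: open_at_def)
  obtain c where c: "c \<in> row (Suc i)" "b < c" using Suc.prems by (auto simp: open_at_def)
  obtain a where a: "a \<in> odds (entry w (Suc (Suc i)))" "a < b"
    using odd_below_if_active[of ?y b] letter_wellformed[of "Suc (Suc i)"] row_Suc[of "Suc i"] Suc.prems b
    by force
  show ?case
  proof (cases "\<exists>c\<in>odds ?x. b < c")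
    case True
    then obtain c where c: "c \<in> odds ?x" "b < c" by blast
    have "b \<in> {1..int n}"
      using a c row_subset[of "Suc i"] row_subset[of "Suc (Suc i)"]
        row_Suc[of i] row_Suc[of "Suc i"] Suc.prems by fastforce
    then obtain k where "Suc (Suc i) < k" "k \<le> n" "in_odd b (entry w k)"
      and none: "\<And>l. Suc (Suc i) < l \<Longrightarrow> l < k \<Longrightarrow> \<not> in_even b (entry w l)"
      using row_entered[of b "Suc (Suc i)"] b Suc.prems by auto
    moreover have "\<not> in_even b (entry w (Suc (Suc i)))"
      using evens_subset_row[of "Suc i"] b Suc.prems by (auto simp: evens_def)
    then have "\<not> in_even b (entry w l)" if "Suc (Suc i) \<le> l" "l < k" for l
      using none[of l] that by (cases "l = Suc (Suc i)") auto
    ultimately have "subpattern_312 w c a b (Suc i) (Suc (Suc i)) k"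
      using a c b gog by (auto simp: subpattern_312_def odds_def gog_word_def)
    then have "contains_312_at w (Suc i)"
      using \<open>Suc (Suc i) < k\<close> by (auto simp: contains_312_at_def)
    then show ?thesis by (intro exI[of _ "Suc i"]) auto
  next
    case False
    then have ci: "c \<in> row i" using c row_Suc[of i] Suc.prems by auto
    then have "1 \<le> i" by (cases i) auto
    have "last ?x \<in> odds ?x" using last_in_odds letter_wellformed(1)[of "Suc i"] Suc.prems by simp
    moreover have "b \<notin> odds ?x" using b row_Suc[of i] Suc.prems by auto
    ultimately have last: "last ?x < b" using False by (metis linorder_neqE)
    have "m \<le> last ?x" if "m \<in> set ?x" for m
      using that strict_sorted_le_last letter_wellformed(2)[of "Suc i"] Suc.prems by simp
    \<comment> \<open>So \<open>?x\<close> does not remove \<open>b\<close>, and \<open>b\<close> was missing before it too.\<close>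
    then have "b \<notin> evens ?x" using last odds_Un_evens[of ?x] by force
    then have "b \<notin> row i" using b row_Suc[of i] Suc.prems by auto
    then have "open_at i b" using b ci c last by (auto simp: open_at_def active_def)
    then show ?thesis using Suc.IH \<open>1 \<le> i\<close> Suc.prems by (meson Suc_lessD le_SucI)
  qed
qed simp

end

theorem theorem5:
  fixes w :: "int list list" and a :: "nat \<Rightarrow> nat \<Rightarrow> int" and n i :: nat
  assumes "gog_word n w"
    and "a = monotone_triangle w"
    and "1 \<le> i" and "i \<le> n - 1"
    and "\<forall>l. 1 \<le> l \<and> l < i \<longrightarrow> \<not> contains_312_at w l"
  shows "contains_312_at w i \<longleftrightarrow> has_gap_at_row a i"
proof -
  interpret gog n w by unfold_locales (rule assms(1))
  have i: "i < n" using assms(3,4) by simp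
  have "contains_312_at w i \<longleftrightarrow> (\<exists>b. open_at i b)"
  proof
    assume "contains_312_at w i"
    then show "\<exists>b. open_at i b" using open_if_contains_312 assms(3) i by blast
  next
    assume "\<exists>b. open_at i b"
    then obtain l where "1 \<le> l" "l \<le> i" "contains_312_at w l"
      using contains_312_if_open assms(3) i by blast
    then show "contains_312_at w i" using assms(5) by (cases "l = i") auto
  qed
  then show ?thesis using gap_iff_open assms(2,3) i by simp
qed

end
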